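(* Let $Q=D(\mathbf p)$ be the Dirichlet distribution with parameters $\mathbf p$. For any data distribution $\mathcal D$ on $\mathcal X\times\mathcal Y$ and any $\mathbf p\in\mathbb R_{>0}^n$, $$\mathbb E_{\mathbf w\sim D(\mathbf p)}\,\ell(\mathbf h_{\mathbf w}(\mathbf x),\mathbf y)=I_{0.5}\big(\|\mathbf p\|_1-p_{\mathcal F},\,p_{\mathcal F}\big),$$ $$b_{\mathcal D}^{D(\mathbf p)}(\mathbf h_{\mathbf p})=\mathbb E_{(\mathbf x,\mathbf y)\sim\mathcal D}\Big[I_{0.5}\big(\|\mathbf p\|_1-p_{\mathcal F},\,p_{\mathcal F}\big)\,\Big|\,p_{\mathcal F}<\|\mathbf p\|_1\Big],$$ $$c_{\mathcal D}^{D(\mathbf p)}(\mathbf h_{\mathbf p})=\mathbb E_{(\mathbf x,\mathbf y)\sim\mathcal D}\Big[I_{0.5}\big(\|\mathbf p\|_1-p_{\mathcal F},\,p_{\mathcal F}\big)\,\Big|\,p_{\mathcal F}\ge\|\mathbf p\|_1\Big],$$ where $p_{\mathcal F}=\sum_{i=1}^n p_i\,\mathbb 1\{\mathbf f_i(\mathbf x)\ne\mathbf y\}$ and $I_x(\cdot,\cdot)$ is the regularized incomplete beta function evaluated at $x$.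
   Context: $\mathcal Y$ is the set of the $k$ one-hot vectors of length $k$ ($k$ is the number of classes). $\mathbf f_1,\dots,\mathbf f_n:\mathcal X\to\mathcal Y$ are fixed base classifiers. For a weight vector $\mathbf v$, $\mathbf h_{\mathbf v}(\mathbf x)=\sum_{i=1}^n v_i\mathbf f_i(\mathbf x)$ is the weighted majority vote, and the loss considered is $$\ell(\mathbf h_{\mathbf v}(\mathbf x),\mathbf y)=\mathbb 1\Big\{\sum_{i=1}^n v_i\,\mathbb 1\{\mathbf f_i(\mathbf x)\ne\mathbf y\}\ge\|\mathbf v\|_1\Big\}.$$ The weight space over which the Dirichlet distribution is taken is the probability simplex $\{\mathbf w\in[0,1]^n:\sum_i w_i=1\}$. For a distribution $Q$ on weight vectors, $$b_{\mathcal D}^Q(\mathbf h_{\mathbf p})=\mathbb E_{(\mathbf x,\mathbf y)\sim\mathcal D}\Big[\mathbb E_{\mathbf w\sim Q}\,\ell(\mathbf h_{\mathbf w}(\mathbf x),\mathbf y)\,\Big|\,\ell(\mathbf h_{\mathbf p}(\mathbf x),\mathbf y)=0\Big],$$ $$c_{\mathcal D}^Q(\mathbf h_{\mathbf p})=\mathbb E_{(\mathbf x,\mathbf y)\sim\mathcal D}\Big[\mathbb E_{\mathbf w\sim Q}\,\ell(\mathbf h_{\mathbf w}(\mathbf x),\mathbf y)\,\Big|\,\ell(\mathbf h_{\mathbf p}(\mathbf x),\mathbf y)=1\Big].$$ $I_x(a,b)$ is the CDF at $x$ of the $\mathrm{Beta}(a,b)$ distribution for $a,b>0$, extended by the limits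 $I_{0.5}(a,0)=0$ for $a>0$ and $I_{0.5}(0,b)=1$ for $b>0$.
   Formalization: The threshold in the loss is ‖v‖₁/2 instead of ‖v‖₁, and the conditioning events are p_F < ‖p‖₁/2 and p_F ≥ ‖p‖₁/2; as printed the formulas fail for n=2, p=(1,1) when exactly one classifier errs (0 versus 1/2). *)

theory Defs
  imports "HOL-Probability.Probability"
begin

definition one_hot :: "(real ^ 'k) set" where
  "one_hot = range (\<lambda>j. axis j 1)"

text \<open>
  Vectors indexed by \<open>1, \<dots>, n\<close> are functions on \<^typ>\<open>nat\<close> of which only the values on \<open>{1..n}\<close>
  are used.
\<close>

definition l1_norm :: "nat \<Rightarrow> (nat \<Rightarrow> real) \<Rightarrow> real" where
  "l1_norm n v = (\<Sum>i\<in>{1..n}. \<bar>v i\<bar>)"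

definition prob_simplex :: "nat \<Rightarrow> (nat \<Rightarrow> real) set" where
  "prob_simplex n = {w. (\<forall>i\<in>{1..n}. w i \<in> {0..1}) \<and> (\<Sum>i\<in>{1..n}. w i) = 1}"

definition weighted_vote ::
  "nat \<Rightarrow> (nat \<Rightarrow> 'x \<Rightarrow> real ^ 'k) \<Rightarrow> (nat \<Rightarrow> real) \<Rightarrow> 'x \<Rightarrow> real ^ 'k" where
  "weighted_vote n f v x = (\<Sum>i\<in>{1..n}. v i *\<^sub>R f i x)"

definition wrong_weight ::
  "nat \<Rightarrow> (nat \<Rightarrow> 'x \<Rightarrow> real ^ 'k) \<Rightarrow> (nat \<Rightarrow> real) \<Rightarrow> 'x \<Rightarrow> real ^ 'k \<Rightarrow> real" where
  "wrong_weight n f v x y = (\<Sum>i\<in>{1..n}. v i * of_bool (f i x \<noteq> y))"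

text \<open>
  A vote is wrong if at least \<^emph>\<open>half\<close> of the total weight is on classifiers that err. The source
  prints the threshold without the factor \<open>1/2\<close>; with that reading the loss is \<open>1\<close> only if every
  classifier of positive weight errs, and the beta function formulas, whose argument is \<open>1/2\<close>,
  fail already for \<open>n = 2\<close> and \<open>p = (1, 1)\<close> when exactly one classifier errs. The lemma
  \<open>vote_loss_eq\<close> below shows that, for nonnegative weights, this is a function of the vote and the
  label.
\<close>

definition vote_loss ::
  "nat \<Rightarrow> (nat \<Rightarrow> 'x \<Rightarrow> real ^ 'k) \<Rightarrow> (nat \<Rightarrow> real) \<Rightarrow> 'x \<Rightarrow> real ^ 'k \<Rightarrow> real" where
  "vote_loss n f v x y = of_bool (wrong_weight n f v x y \<ge> l1_norm n v / 2)"

lemma vote_loss_eq: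
  assumes "\<And>i. i \<in> {1..n} \<Longrightarrow> 0 \<le> v i"
    and "\<And>i. i \<in> {1..n} \<Longrightarrow> f i x \<in> one_hot" and "y \<in> one_hot"
  shows "vote_loss n f v x y =
    of_bool (weighted_vote n f v x \<bullet> y \<le> (\<Sum>j\<in>UNIV. weighted_vote n f v x $ j) / 2)"
proof -
  have inner: "f i x \<bullet> y = 1 - of_bool (f i x \<noteq> y)" if "i \<in> {1..n}" for i
    using assms(2)[OF that] assms(3) by (auto simp: one_hot_def inner_axis_axis axis_eq_axis)
  have total: "(\<Sum>j\<in>UNIV. f i x $ j) = 1" if "i \<in> {1..n}" for i
    using assms(2)[OF that] by (auto simp: one_hot_def axis_def)
  have "weighted_vote n f v x \<bullet> y = (\<Sum>i\<in>{1..n}. v i * (1 - of_bool (f i x \<noteq> y)))"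
    unfolding weighted_vote_def inner_sum_left by (intro sum.cong refl) (simp add: inner)
  then have vote: "weighted_vote n f v x \<bullet> y = (\<Sum>i\<in>{1..n}. v i) - wrong_weight n f v x y"
    by (simp add: wrong_weight_def right_diff_distrib sum_subtractf)
  have "(\<Sum>j\<in>UNIV. weighted_vote n f v x $ j) = (\<Sum>i\<in>{1..n}. v i * (\<Sum>j\<in>UNIV. f i x $ j))"
    unfolding weighted_vote_def sum_component sum_distrib_left by (subst sum.swap) simp
  also have "\<dots> = (\<Sum>i\<in>{1..n}. v i)"
    by (intro sum.cong refl) (simp add: total)
  finally have "(\<Sum>j\<in>UNIV. weighted_vote n f v x $ j) = (\<Sum>i\<in>{1..n}. v i)" .
  moreover have "l1_norm n v = (\<Sum>i\<in>{1..n}. v i)"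
    using assms(1) by (simp add: l1_norm_def)
  ultimately show ?thesis
    by (simp add: vote_loss_def vote)
qed

text \<open>
  The Dirichlet distribution has its usual density in the first \<open>n - 1\<close> coordinates with respect to
  Lebesgue measure; the last coordinate is one minus their sum. For \<open>n = 1\<close> this is the point mass
  at \<open>w 1 = 1\<close>.
\<close>

definition simplex_point :: "nat \<Rightarrow> (nat \<Rightarrow> real) \<Rightarrow> nat \<Rightarrow> real" where
  "simplex_point n u = u(n := 1 - (\<Sum>i\<in>{1..<n}. u i))"

definition dirichlet_density :: "nat \<Rightarrow> (nat \<Rightarrow> real) \<Rightarrow> (nat \<Rightarrow> real) \<Rightarrow> real" where
  "dirichlet_density n p w =
    indicator (prob_simplex n) w * (Gamma (\<Sum>i\<in>{1..n}. p i) / (\<Prod>i\<in>{1..n}. Gamma (p i)))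
      * (\<Prod>i\<in>{1..n}. w i powr (p i - 1))"

definition dirichlet :: "nat \<Rightarrow> (nat \<Rightarrow> real) \<Rightarrow> (nat \<Rightarrow> real) measure" where
  "dirichlet n p =
    distr
      (density (Pi\<^sub>M {1..<n} (\<lambda>_. lborel))
        (\<lambda>u. ennreal (dirichlet_density n p (simplex_point n u))))
      (Pi\<^sub>M {1..n} (\<lambda>_. borel)) (simplex_point n)"

definition beta_density :: "real \<Rightarrow> real \<Rightarrow> real \<Rightarrow> real" where
  "beta_density a b t =
    indicator {0<..<1} t * (t powr (a - 1) * (1 - t) powr (b - 1) / Beta a b)"

text \<open>
  The two degenerate values are the limits for \<open>0 < x < 1\<close> as \<open>b\<close>, respectively \<open>a\<close>, tends to zero
  with the other parameter fixed and positive. The value at \<open>a = b = 0\<close> has no meaning.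
\<close>

definition reg_inc_beta :: "real \<Rightarrow> real \<Rightarrow> real \<Rightarrow> real" where
  "reg_inc_beta x a b =
    (if b = 0 then 0
     else if a = 0 then 1
     else cdf (density lborel (\<lambda>t. ennreal (beta_density a b t))) x)"

text \<open>
  Expectation of \<open>Z\<close> given the event \<open>P\<close>; it is \<open>0\<close> if the event has probability zero.
\<close>

definition cond_expectation :: "'a measure \<Rightarrow> ('a \<Rightarrow> real) \<Rightarrow> ('a \<Rightarrow> bool) \<Rightarrow> real" where
  "cond_expectation M Z P = integral\<^sup>L (uniform_measure M {z \<in> space M. P z}) Z"

definition loss_given_correct ::
  "nat \<Rightarrow> (nat \<Rightarrow> 'x \<Rightarrow> real ^ 'k) \<Rightarrow> ('x \<times> (real ^ 'k)) measure \<Rightarrow> (nat \<Rightarrow> real) measure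
    \<Rightarrow> (nat \<Rightarrow> real) \<Rightarrow> real" where
  "loss_given_correct n f D Q p =
    cond_expectation D (\<lambda>(x, y). \<integral>w. vote_loss n f w x y \<partial>Q) (\<lambda>(x, y). vote_loss n f p x y = 0)"

definition loss_given_wrong ::
  "nat \<Rightarrow> (nat \<Rightarrow> 'x \<Rightarrow> real ^ 'k) \<Rightarrow> ('x \<times> (real ^ 'k)) measure \<Rightarrow> (nat \<Rightarrow> real) measure
    \<Rightarrow> (nat \<Rightarrow> real) \<Rightarrow> real" where
  "loss_given_wrong n f D Q p =
    cond_expectation D (\<lambda>(x, y). \<integral>w. vote_loss n f w x y \<partial>Q) (\<lambda>(x, y). vote_loss n f p x y = 1)"

end

(* Liouville's formula
     int prod_A u_i^(p_i - 1) F(sum_A u) du = (prod_A Gamma(p_i) / Gamma(p_A)) int t^(p_A - 1) F(t) dt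
   over the positive orthant follows by adding one variable at a time, each step being a beta
   integral. Applied to a set A of indices and to the remaining ones, it shows that under the
   Dirichlet distribution the partial sum over A is Beta(p_A, |p| - p_A) distributed. With A the
   classifiers that err, the vote is wrong iff this sum is at least 1/2, i.e. iff the complementary
   sum, which is Beta(|p| - p_A, p_A) distributed, is at most 1/2. The density singles out the last
   coordinate, so the formula is used for whichever of A and its complement avoids it. *)
theory Submission
  imports Defs
begin

declare One_nat_def [simp del]

section \<open>Power kernels and their beta convolutions\<close>

text \<open>This is the truncated power x_+^(a-1). Being zero off the positive half-line, it absorbs
  the indicators of the orthant and of the simplex; being \<open>ennreal\<close>-valued, it lets
  Tonelli apply without integrability conditions.\<close>

definition power_kernel :: "real \<Rightarrow> real \<Rightarrow> ennreal" where
  "power_kernel a x = (if 0 < x then ennreal (x powr (a - 1)) else 0)"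

lemma measurable_power_kernel [measurable]: "power_kernel a \<in> borel_measurable borel"
  unfolding power_kernel_def by measurable

lemma power_kernel_nonpos: "x \<le> 0 \<Longrightarrow> power_kernel a x = 0"
  by (simp add: power_kernel_def)

lemma power_kernel_1 [simp]: "power_kernel a 1 = 1"
  by (simp add: power_kernel_def)

lemma Beta_real_pos: "0 < a \<Longrightarrow> 0 < b \<Longrightarrow> 0 < Beta a (b :: real)"
  by (simp add: Beta_def)

lemma nn_integral_power_kernel_unit:
  assumes "0 < a" "0 < b"
  shows "(\<integral>\<^sup>+x. power_kernel a x * power_kernel b (1 - x) \<partial>lborel) = ennreal (Beta a b)"
proof -
  have "(\<integral>\<^sup>+x. power_kernel a x * power_kernel b (1 - x) \<partial>lborel)
      = (\<integral>\<^sup>+t. ennreal (t powr (a - 1) * (1 - t) powr (b - 1)) * indicator {0..1} t \<partial>lborel)"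
    \<comment> \<open>Both integrands also agree at the endpoints 0 and 1: they vanish there because
      \<open>0 powr c = 0\<close> for every \<open>c\<close>.\<close>
    by (intro nn_integral_cong) (auto simp: power_kernel_def ennreal_mult split: split_indicator)
  also have "\<dots> = ennreal (Beta a b)"
    by (intro nn_integral_has_integral_lebesgue' has_integral_Beta_real assms) auto
  finally show ?thesis .
qed

text \<open>For r > 0, substituting r x for x reduces to the unit interval. The kernels are
  homogeneous of degrees a - 1 and b - 1, and with the Jacobian r this gives the power a + b - 1.
  For r <= 0 the two supports do not meet and both sides are zero.\<close>

lemma nn_integral_power_kernel_convolution:
  assumes "0 < a" "0 < b"
  shows "(\<integral>\<^sup>+x. power_kernel a x * power_kernel b (r - x) \<partial>lborel)
    = ennreal (Beta a b) * power_kernel (a + b) r"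
proof (cases "0 < r")
  case True
  have kernel: "power_kernel c (r * x) = ennreal (r powr (c - 1)) * power_kernel c x" for c x
    using True by (auto simp: power_kernel_def powr_mult ennreal_mult zero_less_mult_iff)
  have "(\<integral>\<^sup>+x. power_kernel a x * power_kernel b (r - x) \<partial>lborel)
      = ennreal r * (\<integral>\<^sup>+x. power_kernel a (r * x) * power_kernel b (r * (1 - x)) \<partial>lborel)"
    using True by (subst nn_integral_real_affine[where c = r and t = 0]) (auto simp: right_diff_distrib)
  also have "\<dots> = ennreal r * (\<integral>\<^sup>+x. ennreal (r powr (a - 1) * r powr (b - 1)) *
      (power_kernel a x * power_kernel b (1 - x)) \<partial>lborel)"
    unfolding kernel by (simp add: ennreal_mult mult_ac)
  also have "\<dots> = ennreal (r * (r powr (a - 1) * r powr (b - 1))) * ennreal (Beta a b)"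
    using True assms
    by (subst nn_integral_cmult) (simp_all add: nn_integral_power_kernel_unit ennreal_mult mult.assoc)
  also have "r * (r powr (a - 1) * r powr (b - 1)) = r powr (a + b - 1)"
    using True powr_add[of r 1 "(a - 1) + (b - 1)"] powr_add[of r "a - 1" "b - 1"]
    by (simp add: algebra_simps)
  finally show ?thesis
    using True by (simp add: power_kernel_def mult.commute)
next
  case False
  then have zero: "power_kernel a x * power_kernel b (r - x) = 0" for x
    by (simp add: power_kernel_def)
  show ?thesis
    unfolding zero using False by (simp add: power_kernel_nonpos)
qed

text \<open>Substitute t = x + y in the inner integral and swap the integrals: F(t) then multiplies
  a convolution of two kernels at t. This is the step that adds one variable in Liouville's
  formula.\<close>

lemma nn_integral_power_kernel_add:
  assumes "0 < a" "0 < b" and [measurable]: "F \<in> borel_measurable borel"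
  shows "(\<integral>\<^sup>+x. power_kernel a x * (\<integral>\<^sup>+y. power_kernel b y * F (x + y) \<partial>lborel) \<partial>lborel)
    = ennreal (Beta a b) * (\<integral>\<^sup>+t. power_kernel (a + b) t * F t \<partial>lborel)"
proof -
  have shift: "(\<integral>\<^sup>+y. power_kernel b y * F (x + y) \<partial>lborel)
      = (\<integral>\<^sup>+t. power_kernel b (t - x) * F t \<partial>lborel)" for x
    by (subst nn_integral_real_affine[where c = 1 and t = "- x"]) auto
  have "(\<integral>\<^sup>+x. power_kernel a x * (\<integral>\<^sup>+y. power_kernel b y * F (x + y) \<partial>lborel) \<partial>lborel)
      = (\<integral>\<^sup>+x. \<integral>\<^sup>+t. power_kernel a x * power_kernel b (t - x) * F t \<partial>lborel \<partial>lborel)"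
    unfolding shift by (simp add: nn_integral_cmult mult.assoc)
  also have "\<dots> = (\<integral>\<^sup>+t. \<integral>\<^sup>+x. power_kernel a x * power_kernel b (t - x) * F t \<partial>lborel \<partial>lborel)"
    by (rule lborel_pair.Fubini') measurable
  also have "\<dots> = (\<integral>\<^sup>+t. ennreal (Beta a b) * (power_kernel (a + b) t * F t) \<partial>lborel)"
    unfolding mult.assoc[symmetric] nn_integral_power_kernel_convolution[OF assms(1,2), symmetric]
    by (intro nn_integral_cong nn_integral_multc) measurable
  finally show ?thesis
    by (simp add: nn_integral_cmult)
qed

section \<open>Liouville's formula\<close>

text \<open>The multivariate beta function, the reciprocal of the normalizing constant of the
  Dirichlet density.\<close>

definition gamma_ratio :: "('i \<Rightarrow> real) \<Rightarrow> 'i set \<Rightarrow> real" where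
  "gamma_ratio p A = (\<Prod>i\<in>A. Gamma (p i)) / Gamma (\<Sum>i\<in>A. p i)"

lemma gamma_ratio_pos:
  assumes "finite A" "A \<noteq> {}" "\<And>i. i \<in> A \<Longrightarrow> 0 < p i"
  shows "0 < gamma_ratio p A"
  unfolding gamma_ratio_def using assms
  by (intro divide_pos_pos prod_pos Gamma_real_pos sum_pos) auto

text \<open>Liouville's formula, by induction on A. Fixing the new variable x leaves the formula for
  A with F shifted by x, so F is generalized in the induction. The induction starts at singletons
  because an empty sum is the constant 0, whose law has no density.\<close>

lemma nn_integral_power_kernel_prod_sum:
  fixes p :: "'i \<Rightarrow> real"
  assumes "finite A" "A \<noteq> {}" "\<And>i. i \<in> A \<Longrightarrow> 0 < p i" "F \<in> borel_measurable borel"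
  shows "(\<integral>\<^sup>+u. (\<Prod>i\<in>A. power_kernel (p i) (u i)) * F (\<Sum>i\<in>A. u i) \<partial>Pi\<^sub>M A (\<lambda>_. lborel))
    = ennreal (gamma_ratio p A) * (\<integral>\<^sup>+t. power_kernel (\<Sum>i\<in>A. p i) t * F t \<partial>lborel)"
proof -
  interpret product_sigma_finite "\<lambda>_ :: 'i. lborel :: real measure" ..
  show ?thesis
    using assms
  proof (induction A arbitrary: F rule: finite_ne_induct)
    case (singleton i)
    note singleton(2)[measurable]
    from singleton(1)[of i] have "Gamma (p i) \<noteq> 0"
      by (simp add: less_imp_neq[OF Gamma_real_pos, symmetric])
    then show ?case
      using product_nn_integral_singleton[of "\<lambda>t. power_kernel (p i) t * F t" i]
      by (simp add: gamma_ratio_def)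
  next
    case (insert i A)
    note insert.prems(2)[measurable]
    have pos: "0 < p i" "0 < (\<Sum>i\<in>A. p i)" "\<And>j. j \<in> A \<Longrightarrow> 0 < p j"
      using insert.hyps insert.prems(1) by (auto intro: sum_pos)
    have sum: "(\<Sum>j\<in>A. (u(i := x)) j) = (\<Sum>j\<in>A. u j)"
      and prod: "(\<Prod>j\<in>A. power_kernel (p j) ((u(i := x)) j)) = (\<Prod>j\<in>A. power_kernel (p j) (u j))"
      for u :: "'i \<Rightarrow> real" and x
      using insert.hyps by (auto intro!: sum.cong prod.cong split: if_splits)
    have "(\<integral>\<^sup>+u. (\<Prod>j\<in>insert i A. power_kernel (p j) (u j)) * F (\<Sum>j\<in>insert i A. u j)
          \<partial>Pi\<^sub>M (insert i A) (\<lambda>_. lborel))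
        = (\<integral>\<^sup>+x. \<integral>\<^sup>+u. (\<Prod>j\<in>insert i A. power_kernel (p j) ((u(i := x)) j)) *
          F (\<Sum>j\<in>insert i A. (u(i := x)) j) \<partial>Pi\<^sub>M A (\<lambda>_. lborel) \<partial>lborel)"
      using insert.hyps by (intro product_nn_integral_insert_rev) auto
    also have "\<dots> = (\<integral>\<^sup>+x. \<integral>\<^sup>+u. power_kernel (p i) x * ((\<Prod>j\<in>A. power_kernel (p j) (u j)) *
          F (x + (\<Sum>j\<in>A. u j))) \<partial>Pi\<^sub>M A (\<lambda>_. lborel) \<partial>lborel)"
      using insert.hyps
      by (simp only: sum.insert prod.insert sum prod fun_upd_same mult.assoc if_True simp_thms)
    also have "\<dots> = (\<integral>\<^sup>+x. power_kernel (p i) x * (ennreal (gamma_ratio p A) *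
          (\<integral>\<^sup>+t. power_kernel (\<Sum>j\<in>A. p j) t * F (x + t) \<partial>lborel)) \<partial>lborel)"
      by (simp add: nn_integral_cmult insert.IH[OF pos(3), where F = "\<lambda>t. F (x + t)" for x])
    also have "\<dots> = ennreal (gamma_ratio p A) * (\<integral>\<^sup>+x. power_kernel (p i) x *
          (\<integral>\<^sup>+t. power_kernel (\<Sum>j\<in>A. p j) t * F (x + t) \<partial>lborel) \<partial>lborel)"
      by (subst nn_integral_cmult[symmetric]) (auto simp: mult_ac)
    also have "\<dots> = ennreal (gamma_ratio p A) * ennreal (Beta (p i) (\<Sum>j\<in>A. p j)) *
          (\<integral>\<^sup>+t. power_kernel (\<Sum>j\<in>insert i A. p j) t * F t \<partial>lborel)"
      using insert.hyps pos by (simp add: nn_integral_power_kernel_add mult.assoc)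
    \<comment> \<open>The Gamma value at the sum over A, in the denominator of
      \<open>gamma_ratio p A\<close>, cancels against the numerator of the beta factor.\<close>
    also have "ennreal (gamma_ratio p A) * ennreal (Beta (p i) (\<Sum>j\<in>A. p j))
        = ennreal (gamma_ratio p (insert i A))"
      using insert.hyps Gamma_real_pos[OF pos(2)] Beta_real_pos[OF pos(1,2)]
      by (simp add: gamma_ratio_def Beta_def ennreal_mult''[symmetric] mult.commute)
    finally show ?case .
  qed
qed

text \<open>Liouville's formula with F(t) = \<open>power_kernel q (r - t)\<close>, followed by one
  more convolution. The value r = 1 gives the total Dirichlet mass; r = 1 - s gives the mass of a
  slice on which other coordinates already sum to s. For empty B the integral is over a one-point
  space and the constant is 1.\<close>

lemma nn_integral_power_kernel_prod_convolution:
  fixes p :: "'i \<Rightarrow> real"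
  assumes "finite B" "\<And>i. i \<in> B \<Longrightarrow> 0 < p i" "0 < q"
  shows "(\<integral>\<^sup>+u. (\<Prod>i\<in>B. power_kernel (p i) (u i)) * power_kernel q (r - (\<Sum>i\<in>B. u i))
      \<partial>Pi\<^sub>M B (\<lambda>_. lborel))
    = ennreal ((\<Prod>i\<in>B. Gamma (p i)) * Gamma q / Gamma ((\<Sum>i\<in>B. p i) + q)) *
      power_kernel ((\<Sum>i\<in>B. p i) + q) r"
proof (cases "B = {}")
  case True
  then show ?thesis
    using assms(3) less_imp_neq[OF Gamma_real_pos, of q] by (simp add: space_PiM_empty)
next
  case False
  have pos: "0 < (\<Sum>i\<in>B. p i)"
    using False assms by (auto intro: sum_pos)
  have "(\<integral>\<^sup>+u. (\<Prod>i\<in>B. power_kernel (p i) (u i)) * power_kernel q (r - (\<Sum>i\<in>B. u i))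
      \<partial>Pi\<^sub>M B (\<lambda>_. lborel)) = ennreal (gamma_ratio p B) *
      (\<integral>\<^sup>+t. power_kernel (\<Sum>i\<in>B. p i) t * power_kernel q (r - t) \<partial>lborel)"
    using assms False
    by (intro nn_integral_power_kernel_prod_sum[where F = "\<lambda>t. power_kernel q (r - t)"]) auto
  also have "\<dots> = ennreal (gamma_ratio p B) * ennreal (Beta (\<Sum>i\<in>B. p i) q) *
      power_kernel ((\<Sum>i\<in>B. p i) + q) r"
    using pos assms by (simp add: nn_integral_power_kernel_convolution mult.assoc)
  also have "ennreal (gamma_ratio p B) * ennreal (Beta (\<Sum>i\<in>B. p i) q)
      = ennreal ((\<Prod>i\<in>B. Gamma (p i)) * Gamma q / Gamma ((\<Sum>i\<in>B. p i) + q))"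
    using Gamma_real_pos[OF pos] Beta_real_pos[OF pos assms(3)]
    by (simp add: gamma_ratio_def Beta_def ennreal_mult''[symmetric])
  finally show ?thesis .
qed

section \<open>The Dirichlet distribution in terms of power kernels\<close>

lemma measurable_simplex_point [measurable]:
  assumes "1 \<le> n"
  shows "simplex_point n \<in> Pi\<^sub>M {1..<n} (\<lambda>_. lborel) \<rightarrow>\<^sub>M Pi\<^sub>M {1..n} (\<lambda>_. borel)"
proof -
  have I: "{1..n} = {1..<n} \<union> {n}"
    using assms by auto
  have "sets (Pi\<^sub>M {1..<n} (\<lambda>_. lborel :: real measure)) = sets (Pi\<^sub>M {1..<n} (\<lambda>_. borel))"
    by (intro sets_PiM_cong) auto
  then have "(\<lambda>u. u) \<in> Pi\<^sub>M {1..<n} (\<lambda>_. lborel :: real measure) \<rightarrow>\<^sub>M Pi\<^sub>M {1..<n} (\<lambda>_. borel)"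
    by (intro measurable_ident_sets)
  then show ?thesis
    unfolding simplex_point_def[abs_def] by (intro measurable_fun_upd[OF I]) auto
qed

lemma sum_simplex_point: "1 \<le> n \<Longrightarrow> (\<Sum>i\<in>{1..n}. simplex_point n u i) = 1"
  by (simp add: simplex_point_def atLeastLessThanSuc_atLeastAtMost[symmetric] atLeastLessThanSuc)

text \<open>On the hyperplane of sum 1, positive coordinates are automatically at most 1, so
  positivity alone puts w in the simplex and the kernels can replace its indicator.\<close>

lemma dirichlet_density_eq_power_kernel:
  assumes pos: "\<And>i. i \<in> {1..n} \<Longrightarrow> 0 < p i" and sum: "(\<Sum>i\<in>{1..n}. w i) = 1"
  shows "ennreal (dirichlet_density n p w)
    = ennreal (1 / gamma_ratio p {1..n}) * (\<Prod>i\<in>{1..n}. power_kernel (p i) (w i))"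
proof (cases "\<forall>i\<in>{1..n}. 0 < w i")
  case True
  have "w i \<le> 1" if "i \<in> {1..n}" for i
    unfolding sum[symmetric] using that True by (intro member_le_sum) (auto simp: less_imp_le)
  then have "w \<in> prob_simplex n"
    using True sum by (auto simp: prob_simplex_def less_imp_le)
  moreover have "(\<Prod>i\<in>{1..n}. power_kernel (p i) (w i)) = ennreal (\<Prod>i\<in>{1..n}. w i powr (p i - 1))"
    unfolding prod_ennreal[OF powr_ge_zero, symmetric] using True
    by (intro prod.cong) (auto simp: power_kernel_def)
  moreover have "0 < gamma_ratio p {1..n}"
  proof (rule gamma_ratio_pos)
    show "{1..n} \<noteq> {}"
      using sum by (metis sum.empty zero_neq_one)
  qed (use pos in auto)
  moreover have "0 \<le> (\<Prod>i\<in>{1..n}. w i powr (p i - 1))"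
    by (intro prod_nonneg) auto
  ultimately show ?thesis
    by (simp add: dirichlet_density_def gamma_ratio_def ennreal_mult''[symmetric])
next
  case False
  then obtain i where i: "i \<in> {1..n}" "w i \<le> 0"
    by (auto simp: not_less)
  then have "(\<Prod>i\<in>{1..n}. power_kernel (p i) (w i)) = 0"
    by (intro prod_zero) (auto intro!: bexI[of _ i] simp: power_kernel_nonpos)
  moreover have "dirichlet_density n p w = 0"
  \<comment> \<open>On a boundary face the product is zero by the convention
    \<open>0 powr c = 0\<close>, even for exponents below zero; a negative coordinate is excluded by
    the indicator.\<close>
  proof (cases "w i = 0")
    case True
    with i(1) have "(\<Prod>i\<in>{1..n}. w i powr (p i - 1)) = 0"
      by (intro prod_zero) auto
    then show ?thesis
      by (simp add: dirichlet_density_def)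
  next
    case False
    with i have "w \<notin> prob_simplex n"
      by (auto simp: prob_simplex_def intro!: bexI[of _ i])
    then show ?thesis
      by (simp add: dirichlet_density_def)
  qed
  ultimately show ?thesis
    by simp
qed

text \<open>\<open>prob_simplex n\<close> restricts only the coordinates in \<open>{1..n}\<close>
  and so is not a subset of the product space, which consists of extensional functions. Its trace on
  the space is measurable and has the same indicator there.\<close>

lemma measurable_dirichlet_density:
  "dirichlet_density n p \<in> borel_measurable (Pi\<^sub>M {1..n} (\<lambda>_. borel))"
proof -
  have [measurable]: "{w \<in> space (Pi\<^sub>M {1..n} (\<lambda>_. borel)). w \<in> prob_simplex n}
      \<in> sets (Pi\<^sub>M {1..n} (\<lambda>_. borel))"
    unfolding prob_simplex_def by measurable
  have "(\<lambda>w. indicator {w \<in> space (Pi\<^sub>M {1..n} (\<lambda>_. borel)). w \<in> prob_simplex n} w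
        * (Gamma (\<Sum>i\<in>{1..n}. p i) / (\<Prod>i\<in>{1..n}. Gamma (p i)))
        * (\<Prod>i\<in>{1..n}. w i powr (p i - 1))) \<in> borel_measurable (Pi\<^sub>M {1..n} (\<lambda>_. borel))"
    by measurable
  also have "?this \<longleftrightarrow> ?thesis"
    by (intro measurable_cong) (auto simp: dirichlet_density_def split: split_indicator)
  finally show ?thesis .
qed

lemma space_dirichlet [simp]: "space (dirichlet n p) = space (Pi\<^sub>M {1..n} (\<lambda>_. borel))"
  and sets_dirichlet [simp, measurable_cong]:
    "sets (dirichlet n p) = sets (Pi\<^sub>M {1..n} (\<lambda>_. borel))"
  by (simp_all add: dirichlet_def)

text \<open>The density carries the indicator of the simplex. This later allows replacing the norm
  by 1 and a partial sum by one minus the complementary sum.\<close>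

lemma AE_dirichlet_prob_simplex:
  assumes "1 \<le> n"
  shows "AE w in dirichlet n p. w \<in> prob_simplex n"
proof -
  note measurable_simplex_point[OF assms, measurable] measurable_dirichlet_density[measurable]
  have "{w \<in> space (Pi\<^sub>M {1..n} (\<lambda>_. borel)). w \<in> prob_simplex n} \<in> sets (Pi\<^sub>M {1..n} (\<lambda>_. borel))"
    unfolding prob_simplex_def by measurable
  then show ?thesis
    unfolding dirichlet_def
    by (subst AE_distr_iff)
      (auto simp: AE_density dirichlet_density_def split: split_indicator)
qed

text \<open>The last coordinate enters the weight only through a kernel at one minus the sum of the
  others, which is the shape of the convolution formula above.\<close>

lemma nn_integral_dirichlet:
  assumes "1 \<le> n" and pos: "\<And>i. i \<in> {1..n} \<Longrightarrow> 0 < p i"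
    and h [measurable]: "h \<in> borel_measurable (Pi\<^sub>M {1..n} (\<lambda>_. borel))"
  shows "(\<integral>\<^sup>+w. h w \<partial>dirichlet n p) = ennreal (1 / gamma_ratio p {1..n}) *
    (\<integral>\<^sup>+u. (\<Prod>i\<in>{1..<n}. power_kernel (p i) (u i)) * power_kernel (p n) (1 - (\<Sum>i\<in>{1..<n}. u i))
      * h (simplex_point n u) \<partial>Pi\<^sub>M {1..<n} (\<lambda>_. lborel))"
proof -
  note measurable_simplex_point[OF assms(1), measurable] measurable_dirichlet_density[measurable]
  have I: "{1..n} = insert n {1..<n}"
    using assms by auto
  have *: "(\<Prod>i\<in>{1..n}. power_kernel (p i) (simplex_point n u i))
      = (\<Prod>i\<in>{1..<n}. power_kernel (p i) (u i)) * power_kernel (p n) (1 - (\<Sum>i\<in>{1..<n}. u i))" for u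
    unfolding I by (subst prod.insert)
      (auto simp: simplex_point_def mult.commute intro!: arg_cong2[where f = "(*)"] prod.cong)
  have "(\<integral>\<^sup>+w. h w \<partial>dirichlet n p)
      = (\<integral>\<^sup>+u. ennreal (dirichlet_density n p (simplex_point n u)) * h (simplex_point n u)
        \<partial>Pi\<^sub>M {1..<n} (\<lambda>_. lborel))"
    unfolding dirichlet_def by (simp add: nn_integral_distr nn_integral_density)
  also have "\<dots> = (\<integral>\<^sup>+u. ennreal (1 / gamma_ratio p {1..n}) *
      ((\<Prod>i\<in>{1..<n}. power_kernel (p i) (u i)) * power_kernel (p n) (1 - (\<Sum>i\<in>{1..<n}. u i))
        * h (simplex_point n u)) \<partial>Pi\<^sub>M {1..<n} (\<lambda>_. lborel))"
    using assms by (simp only: dirichlet_density_eq_power_kernel sum_simplex_point * mult.assoc)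
  finally show ?thesis
    by (simp add: nn_integral_cmult)
qed

lemma prob_space_dirichlet:
  assumes "1 \<le> n" and pos: "\<And>i. i \<in> {1..n} \<Longrightarrow> 0 < p i"
  shows "prob_space (dirichlet n p)"
proof
  have I: "{1..n} = insert n {1..<n}"
    using assms by auto
  have "emeasure (dirichlet n p) (space (dirichlet n p)) = (\<integral>\<^sup>+w. 1 \<partial>dirichlet n p)"
    by simp
  \<comment> \<open>The convolution formula at r = 1, where the resulting kernel has value
    1.\<close>
  also have "\<dots> = ennreal (1 / gamma_ratio p {1..n}) *
      ennreal ((\<Prod>i\<in>{1..<n}. Gamma (p i)) * Gamma (p n) / Gamma ((\<Sum>i\<in>{1..<n}. p i) + p n))"
    using assms nn_integral_power_kernel_prod_convolution[of "{1..<n}" p "p n" 1]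
    by (subst nn_integral_dirichlet) simp_all
  also have "(\<Prod>i\<in>{1..<n}. Gamma (p i)) * Gamma (p n) / Gamma ((\<Sum>i\<in>{1..<n}. p i) + p n)
      = gamma_ratio p {1..n}"
    unfolding I by (simp add: gamma_ratio_def add.commute mult.commute)
  also have "ennreal (1 / gamma_ratio p {1..n}) * ennreal (gamma_ratio p {1..n}) = 1"
    using gamma_ratio_pos[of "{1..n}" p] assms by (simp add: ennreal_mult''[symmetric])
  finally show "emeasure (dirichlet n p) (space (dirichlet n p)) = 1" .
qed

section \<open>Partial sums are beta distributed\<close>

lemma beta_density_eq_power_kernel:
  assumes "0 < a" "0 < b"
  shows "ennreal (beta_density a b t)
    = ennreal (1 / Beta a b) * (power_kernel a t * power_kernel b (1 - t))"
  using Beta_real_pos[OF assms]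
  by (auto simp: beta_density_def power_kernel_def ennreal_mult''[symmetric] split: split_indicator)

text \<open>Let s be the sum over A. Integrating out the remaining free coordinates B leaves a
  multiple of \<open>power_kernel b (1 - s)\<close>; Liouville's formula on A then yields an
  unnormalized beta density in s. A avoids \<open>n\<close> because the last coordinate is not an
  integration variable.\<close>

lemma nn_integral_dirichlet_partial_sum:
  assumes "1 \<le> n" and pos: "\<And>i. i \<in> {1..n} \<Longrightarrow> 0 < p i"
    and A: "A \<subseteq> {1..<n}" "A \<noteq> {}"
    and g [measurable]: "g \<in> borel_measurable borel"
  shows "(\<integral>\<^sup>+w. g (\<Sum>i\<in>A. w i) \<partial>dirichlet n p)
    = (\<integral>\<^sup>+t. ennreal (beta_density (\<Sum>i\<in>A. p i) (\<Sum>i\<in>{1..n} - A. p i) t) * g t \<partial>lborel)"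
proof -
  interpret product_sigma_finite "\<lambda>_ :: nat. lborel :: real measure" ..
  define B where "B = {1..<n} - A"
  have [simp]: "finite A" "finite B"
    using A finite_subset by (auto simp: B_def)
  have AB: "{1..<n} = A \<union> B" "A \<inter> B = {}" and B': "{1..n} - A = insert n B"
    and nB: "n \<notin> B" and I: "{1..n} = A \<union> insert n B" and AB': "A \<inter> insert n B = {}"
    using A assms(1) by (auto simp: B_def)
  have sumA: "(\<Sum>i\<in>A. simplex_point n u i) = (\<Sum>i\<in>A. u i)" for u
    using A by (intro sum.cong) (auto simp: simplex_point_def)
  define a b where "a = (\<Sum>i\<in>A. p i)" and "b = (\<Sum>i\<in>insert n B. p i)"
  \<comment> \<open>The constant from integrating out B together with the kernel of coordinate
    \<open>n\<close>; it is \<open>gamma_ratio p (insert n B)\<close>.\<close>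
  define c where "c = (\<Prod>i\<in>B. Gamma (p i)) * Gamma (p n) / Gamma b"
  have b_eq: "(\<Sum>i\<in>B. p i) + p n = b"
    using nB by (simp add: b_def add.commute)
  have ab: "0 < a" "0 < b"
    unfolding a_def b_def using A pos I by (auto intro!: sum_pos)
  have c: "0 < c"
    unfolding c_def using ab assms(1) pos
    by (intro divide_pos_pos mult_pos_pos prod_pos Gamma_real_pos) (auto simp: B_def)
  have A_pos: "0 < gamma_ratio p A"
    using A pos I by (intro gamma_ratio_pos) auto
  have sum_total: "(\<Sum>i\<in>{1..n}. p i) = a + b"
    unfolding I a_def b_def using AB' by (intro sum.union_disjoint) auto
  have prod_total: "(\<Prod>i\<in>{1..n}. Gamma (p i))
      = (\<Prod>i\<in>A. Gamma (p i)) * ((\<Prod>i\<in>B. Gamma (p i)) * Gamma (p n))"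
    unfolding I using AB' nB by (subst prod.union_disjoint) (auto simp: mult.commute)
  have "gamma_ratio p {1..n} = gamma_ratio p A * c * Beta a b"
    using ab[THEN Gamma_real_pos]
    unfolding gamma_ratio_def c_def Beta_def prod_total sum_total a_def[symmetric]
    by simp
  then have const: "ennreal (1 / gamma_ratio p {1..n}) * (ennreal (gamma_ratio p A) * ennreal c)
      = ennreal (1 / Beta a b)"
    using A_pos c Beta_real_pos[OF ab] by (simp add: ennreal_mult''[symmetric])
  have inner: "(\<integral>\<^sup>+v. (\<Prod>i\<in>B. power_kernel (p i) (v i)) * power_kernel (p n) (1 - s - (\<Sum>i\<in>B. v i))
      \<partial>Pi\<^sub>M B (\<lambda>_. lborel)) = ennreal c * power_kernel b (1 - s)" for s
    using pos I by (subst nn_integral_power_kernel_prod_convolution) (auto simp: b_eq c_def)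
  \<comment> \<open>The A and B coordinates interact only through the argument of the last kernel,
    so for fixed u the integral over v is the one in \<open>inner\<close>.\<close>
  have merge: "(\<Prod>i\<in>A \<union> B. power_kernel (p i) (merge A B (u, v) i))
        * power_kernel (p n) (1 - (\<Sum>i\<in>A \<union> B. merge A B (u, v) i)) * g (\<Sum>i\<in>A. merge A B (u, v) i)
      = (\<Prod>i\<in>A. power_kernel (p i) (u i)) * g (\<Sum>i\<in>A. u i) * ((\<Prod>i\<in>B. power_kernel (p i) (v i))
        * power_kernel (p n) (1 - (\<Sum>i\<in>A. u i) - (\<Sum>i\<in>B. v i)))" for u v
  proof -
    have "(\<Prod>i\<in>A. power_kernel (p i) (merge A B (u, v) i)) = (\<Prod>i\<in>A. power_kernel (p i) (u i))"
      "(\<Prod>i\<in>B. power_kernel (p i) (merge A B (u, v) i)) = (\<Prod>i\<in>B. power_kernel (p i) (v i))"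
      "(\<Sum>i\<in>A. merge A B (u, v) i) = (\<Sum>i\<in>A. u i)"
      "(\<Sum>i\<in>B. merge A B (u, v) i) = (\<Sum>i\<in>B. v i)"
      using AB(2) by (auto intro!: prod.cong sum.cong)
    then show ?thesis
      using AB(2) by (simp add: prod.union_disjoint sum.union_disjoint diff_diff_eq mult_ac)
  qed
  have "(\<integral>\<^sup>+w. g (\<Sum>i\<in>A. w i) \<partial>dirichlet n p) = ennreal (1 / gamma_ratio p {1..n}) *
      (\<integral>\<^sup>+u. (\<Prod>i\<in>A \<union> B. power_kernel (p i) (u i)) * power_kernel (p n) (1 - (\<Sum>i\<in>A \<union> B. u i))
        * g (\<Sum>i\<in>A. u i) \<partial>Pi\<^sub>M (A \<union> B) (\<lambda>_. lborel))"
    using assms(1) pos A I unfolding AB(1)[symmetric]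
    by (subst nn_integral_dirichlet) (auto simp: sumA)
  also have "(\<integral>\<^sup>+u. (\<Prod>i\<in>A \<union> B. power_kernel (p i) (u i)) * power_kernel (p n) (1 - (\<Sum>i\<in>A \<union> B. u i))
        * g (\<Sum>i\<in>A. u i) \<partial>Pi\<^sub>M (A \<union> B) (\<lambda>_. lborel))
      = (\<integral>\<^sup>+u. \<integral>\<^sup>+v. (\<Prod>i\<in>A. power_kernel (p i) (u i)) * g (\<Sum>i\<in>A. u i) *
        ((\<Prod>i\<in>B. power_kernel (p i) (v i)) * power_kernel (p n) (1 - (\<Sum>i\<in>A. u i) - (\<Sum>i\<in>B. v i)))
        \<partial>Pi\<^sub>M B (\<lambda>_. lborel) \<partial>Pi\<^sub>M A (\<lambda>_. lborel))"
    using AB(2) by (subst product_nn_integral_fold) (simp_all only: merge, auto)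
  also have "\<dots> = (\<integral>\<^sup>+u. (\<Prod>i\<in>A. power_kernel (p i) (u i)) * (g (\<Sum>i\<in>A. u i) *
        (ennreal c * power_kernel b (1 - (\<Sum>i\<in>A. u i)))) \<partial>Pi\<^sub>M A (\<lambda>_. lborel))"
    by (simp add: nn_integral_cmult inner mult.assoc)
  also have "\<dots> = ennreal (gamma_ratio p A) *
        (\<integral>\<^sup>+t. power_kernel a t * (g t * (ennreal c * power_kernel b (1 - t))) \<partial>lborel)"
    unfolding a_def using A pos I
    by (intro nn_integral_power_kernel_prod_sum
        [where F = "\<lambda>t. g t * (ennreal c * power_kernel b (1 - t))"]) auto
  also have "\<dots> = (ennreal (gamma_ratio p A) * ennreal c) *
        (\<integral>\<^sup>+t. power_kernel a t * power_kernel b (1 - t) * g t \<partial>lborel)"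
    by (subst mult.assoc, subst nn_integral_cmult[symmetric]) (auto simp: mult_ac)
  finally have "(\<integral>\<^sup>+w. g (\<Sum>i\<in>A. w i) \<partial>dirichlet n p) = ennreal (1 / Beta a b) *
        (\<integral>\<^sup>+t. power_kernel a t * power_kernel b (1 - t) * g t \<partial>lborel)"
    by (simp only: mult.assoc[symmetric] const[unfolded mult.assoc[symmetric]])
  then show ?thesis
    unfolding B' a_def[symmetric] b_def[symmetric]
    by (simp add: beta_density_eq_power_kernel[OF ab] nn_integral_cmult mult.assoc)
qed

section \<open>Tail probabilities as incomplete beta values\<close>

lemma beta_density_reflect: "beta_density a b (1 - t) = beta_density b a t"
  by (auto simp: beta_density_def Beta_commute split: split_indicator)

lemma measurable_beta_density [measurable]: "beta_density a b \<in> borel_measurable borel"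
  unfolding beta_density_def[abs_def] by measurable

lemma reg_inc_beta_eq:
  assumes "a \<noteq> 0" "b \<noteq> 0"
  shows "reg_inc_beta x a b = enn2real (\<integral>\<^sup>+t. ennreal (beta_density a b t) * indicator {..x} t \<partial>lborel)"
  using assms by (simp add: reg_inc_beta_def cdf_def measure_def emeasure_density)

text \<open>Puts the probability of an event about a partial sum into the integral form of the
  preceding part, with an indicator as \<open>g\<close>.\<close>

lemma emeasure_Collect_mem:
  assumes [measurable]: "f \<in> borel_measurable M" "S \<in> sets borel"
  shows "emeasure M {x \<in> space M. f x \<in> S} = (\<integral>\<^sup>+x. indicator S (f x) \<partial>M)"
proof -
  have "(\<integral>\<^sup>+x. indicator S (f x) \<partial>M) = (\<integral>\<^sup>+x. indicator {x \<in> space M. f x \<in> S} x \<partial>M)"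
    by (intro nn_integral_cong) (auto split: split_indicator)
  then show ?thesis
    by simp
qed

text \<open>If A is empty, the event is impossible since s < 1; if A is everything, it is almost
  sure since 0 <= s. These match the two degenerate values. Otherwise exactly one of A and its
  complement avoids \<open>n\<close>, and the beta law is applied to that one.\<close>

lemma measure_dirichlet_partial_sum_ge:
  assumes "1 \<le> n" and pos: "\<And>i. i \<in> {1..n} \<Longrightarrow> 0 < p i"
    and A: "A \<subseteq> {1..n}" and s: "0 \<le> s" "s < 1"
  shows "measure (dirichlet n p) {w \<in> space (dirichlet n p). 1 - s \<le> (\<Sum>i\<in>A. w i)}
    = reg_inc_beta s (\<Sum>i\<in>{1..n} - A. p i) (\<Sum>i\<in>A. p i)"
proof -
  interpret prob_space "dirichlet n p"
    using assms by (intro prob_space_dirichlet)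
  have [measurable]: "(\<lambda>w. w i :: real) \<in> borel_measurable (Pi\<^sub>M {1..n} (\<lambda>_. borel))"
    if "i \<in> A" for i
    using that A by auto
  have fin: "finite A"
    using A finite_subset by auto
  consider "A = {}" | "A = {1..n}" | "A \<noteq> {}" "n \<notin> A" | "n \<in> A" "A \<noteq> {1..n}"
    by auto
  then show ?thesis
  proof cases
    case 1
    with s show ?thesis
      by (simp add: reg_inc_beta_def)
  next
    case 2
    have "AE w in dirichlet n p. 1 - s \<le> (\<Sum>i\<in>A. w i)"
      using 2 s by (intro eventually_mono[OF AE_dirichlet_prob_simplex[OF assms(1)]])
        (simp add: prob_simplex_def)
    then have "prob {w \<in> space (dirichlet n p). 1 - s \<le> (\<Sum>i\<in>A. w i)} = 1"
      by (intro prob_Collect_eq_1[THEN iffD2]) auto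
    \<comment> \<open>\<open>reg_inc_beta\<close> tests its second parameter for zero first, so the
      value 1 requires the total weight to be nonzero.\<close>
    moreover have "0 < (\<Sum>i\<in>{1..n}. p i)"
      using assms by (intro sum_pos) auto
    ultimately show ?thesis
      using 2 by (simp add: reg_inc_beta_def)
  next
    case 3
    define a b where "a = (\<Sum>i\<in>A. p i)" and "b = (\<Sum>i\<in>{1..n} - A. p i)"
    have ab: "0 < a" "0 < b"
      unfolding a_def b_def using 3 A pos assms(1) fin by (auto intro!: sum_pos)
    have "A \<subseteq> {1..<n}"
      using 3 A by (auto simp: le_less)
    then have "emeasure (dirichlet n p) {w \<in> space (dirichlet n p). 1 - s \<le> (\<Sum>i\<in>A. w i)}
        = (\<integral>\<^sup>+t. ennreal (beta_density a b t) * indicator {1 - s..} t \<partial>lborel)"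
      unfolding a_def b_def using 3 assms
      by (subst nn_integral_dirichlet_partial_sum[symmetric]) (auto simp flip: emeasure_Collect_mem)
    also have "\<dots> = (\<integral>\<^sup>+t. ennreal (beta_density b a t) * indicator {..s} t \<partial>lborel)"
      \<comment> \<open>The reflection of t to 1 - t swaps the beta parameters and turns the upper
        tail from 1 - s into the lower tail up to s.\<close>
      by (subst nn_integral_real_affine[where c = "-1" and t = 1])
        (auto simp: beta_density_reflect intro!: nn_integral_cong split: split_indicator)
    finally show ?thesis
      using ab unfolding a_def[symmetric] b_def[symmetric] by (simp add: reg_inc_beta_eq measure_def)
  next
    case 4
    define B where "B = {1..n} - A"
    have B: "B \<subseteq> {1..<n}" "B \<noteq> {}" "{1..n} - B = A"
      using 4 A by (auto simp: B_def le_less)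
    have [measurable]: "(\<lambda>w. w i :: real) \<in> borel_measurable (Pi\<^sub>M {1..n} (\<lambda>_. borel))"
      if "i \<in> B" for i
      using that by (auto simp: B_def)
    define a b where "a = (\<Sum>i\<in>A. p i)" and "b = (\<Sum>i\<in>B. p i)"
    have ab: "0 < a" "0 < b"
      unfolding a_def b_def using 4 A pos B fin finite_subset[OF B(1)] by (auto intro!: sum_pos)
    \<comment> \<open>On the simplex the sums over A and B add up to 1, so the event is already a
      lower tail for B and no reflection is required.\<close>
    have "(1 - s \<le> (\<Sum>i\<in>A. w i)) = ((\<Sum>i\<in>B. w i) \<le> s)" if "w \<in> prob_simplex n" for w
      using that sum.subset_diff[OF A, of w] by (auto simp: prob_simplex_def B_def)
    then have "emeasure (dirichlet n p) {w \<in> space (dirichlet n p). 1 - s \<le> (\<Sum>i\<in>A. w i)}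
        = emeasure (dirichlet n p) {w \<in> space (dirichlet n p). (\<Sum>i\<in>B. w i) \<le> s}"
      using AE_dirichlet_prob_simplex[OF assms(1), of p] by (intro emeasure_eq_AE) auto
    also have "\<dots> = (\<integral>\<^sup>+t. ennreal (beta_density b a t) * indicator {..s} t \<partial>lborel)"
      unfolding a_def b_def B(3)[symmetric] using B assms
      by (subst nn_integral_dirichlet_partial_sum[symmetric]) (auto simp flip: emeasure_Collect_mem)
    finally show ?thesis
      using ab unfolding a_def[symmetric] B_def[symmetric] b_def[symmetric]
      by (simp add: reg_inc_beta_eq measure_def)
  qed
qed

section \<open>Expected loss and its conditional versions\<close>

lemma wrong_weight_eq_sum:
  "wrong_weight n f v x y = (\<Sum>i\<in>{i \<in> {1..n}. f i x \<noteq> y}. v i)"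
  unfolding wrong_weight_def sum.inter_filter[OF finite_atLeastAtMost]
  by (intro sum.cong) auto

lemma measurable_vote_loss [measurable]:
  "(\<lambda>w. vote_loss n f w x y) \<in> borel_measurable (Pi\<^sub>M {1..n} (\<lambda>_. borel))"
  unfolding vote_loss_def wrong_weight_eq_sum l1_norm_def not_less[symmetric] by measurable

lemma integral_vote_loss_dirichlet:
  assumes "1 \<le> n" and pos: "\<And>i. i \<in> {1..n} \<Longrightarrow> 0 < p i"
  shows "(\<integral>w. vote_loss n f w x y \<partial>dirichlet n p)
    = reg_inc_beta (1/2) (l1_norm n p - wrong_weight n f p x y) (wrong_weight n f p x y)"
proof -
  define A where "A = {i \<in> {1..n}. f i x \<noteq> y}"
  have A: "A \<subseteq> {1..n}"
    by (auto simp: A_def)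
  have [measurable]: "(\<lambda>w. w i :: real) \<in> borel_measurable (Pi\<^sub>M {1..n} (\<lambda>_. borel))"
    if "i \<in> A" for i
    using that A by auto
  \<comment> \<open>The threshold 1/2 is written as 1 - s with s = 1/2, to match the tail
    formula.\<close>
  let ?E = "{w \<in> space (dirichlet n p). 1 - 1/2 \<le> (\<Sum>i\<in>A. w i)}"
  have "(\<integral>w. vote_loss n f w x y \<partial>dirichlet n p) = (\<integral>w. indicator ?E w \<partial>dirichlet n p)"
  \<comment> \<open>The loss compares with half the norm of w, which equals 1/2 only on the simplex;
    hence equality is obtained almost everywhere.\<close>
  proof (intro integral_cong_AE)
    show "(\<lambda>w. vote_loss n f w x y) \<in> borel_measurable (dirichlet n p)"
      by measurable
    have "vote_loss n f w x y = indicator ?E w"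
      if "w \<in> prob_simplex n" "w \<in> space (dirichlet n p)" for w
      using that by (auto simp: vote_loss_def wrong_weight_eq_sum A_def l1_norm_def prob_simplex_def)
    then show "AE w in dirichlet n p. vote_loss n f w x y = indicator ?E w"
      using AE_dirichlet_prob_simplex[OF assms(1), of p] by (auto elim: eventually_mono)
  qed auto
  also have "\<dots> = measure (dirichlet n p) ?E"
    by (simp add: Int_absorb2)
  also have "\<dots> = reg_inc_beta (1/2) (\<Sum>i\<in>{1..n} - A. p i) (\<Sum>i\<in>A. p i)"
    using assms A by (intro measure_dirichlet_partial_sum_ge) auto
  also have "(\<Sum>i\<in>{1..n} - A. p i) = l1_norm n p - (\<Sum>i\<in>A. p i)"
  proof -
    have "l1_norm n p = (\<Sum>i\<in>{1..n}. p i)"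
      unfolding l1_norm_def using pos by (intro sum.cong) (auto simp: less_imp_le)
    then show ?thesis
      using A by (simp add: sum_diff)
  qed
  finally show ?thesis
    by (simp add: wrong_weight_eq_sum A_def)
qed

lemma cond_expectation_cong:
  assumes "\<And>z. z \<in> space M \<Longrightarrow> Z z = Z' z" "\<And>z. z \<in> space M \<Longrightarrow> P z = P' z"
  shows "cond_expectation M Z P = cond_expectation M Z' P'"
proof -
  have "{z \<in> space M. P z} = {z \<in> space M. P' z}"
    using assms by auto
  then show ?thesis
    unfolding cond_expectation_def using assms by (auto intro!: Bochner_Integration.integral_cong)
qed

theorem proposition4:
  fixes n :: nat
    and MX :: "'x measure"
    and f :: "nat \<Rightarrow> 'x \<Rightarrow> real ^ 'k"
    and D :: "('x \<times> (real ^ 'k)) measure"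
    and p :: "nat \<Rightarrow> real"
  assumes "n \<ge> 1"
    and "\<And>i. i \<in> {1..n} \<Longrightarrow> f i \<in> MX \<rightarrow>\<^sub>M count_space one_hot"
    and "prob_space D"
    and "sets D = sets (MX \<Otimes>\<^sub>M count_space one_hot)"
    and "\<And>i. i \<in> {1..n} \<Longrightarrow> p i > 0"
  shows "(\<forall>x\<in>space MX. \<forall>y\<in>one_hot.
           (\<integral>w. vote_loss n f w x y \<partial>dirichlet n p)
             = reg_inc_beta (1/2) (l1_norm n p - wrong_weight n f p x y) (wrong_weight n f p x y))
    \<and> loss_given_correct n f D (dirichlet n p) p
        = cond_expectation D
            (\<lambda>(x, y). reg_inc_beta (1/2) (l1_norm n p - wrong_weight n f p x y)
                        (wrong_weight n f p x y))
            (\<lambda>(x, y). wrong_weight n f p x y < l1_norm n p / 2)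
    \<and> loss_given_wrong n f D (dirichlet n p) p
        = cond_expectation D
            (\<lambda>(x, y). reg_inc_beta (1/2) (l1_norm n p - wrong_weight n f p x y)
                        (wrong_weight n f p x y))
            (\<lambda>(x, y). wrong_weight n f p x y \<ge> l1_norm n p / 2)"
proof (intro conjI ballI)
  \<comment> \<open>The loss of \<open>p\<close> takes only the values 0 and 1, so conditioning on
    it is conditioning on either side of the threshold.\<close>
  have loss_iff: "vote_loss n f p x y = 0 \<longleftrightarrow> wrong_weight n f p x y < l1_norm n p / 2"
    "vote_loss n f p x y = 1 \<longleftrightarrow> wrong_weight n f p x y \<ge> l1_norm n p / 2" for x y
    by (auto simp: vote_loss_def)
  \<comment> \<open>Besides being the first claim, this rewrites the integrand inside both
    conditional expectations below.\<close>
  show vote_loss: "(\<integral>w. vote_loss n f w x y \<partial>dirichlet n p)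
      = reg_inc_beta (1/2) (l1_norm n p - wrong_weight n f p x y) (wrong_weight n f p x y)" for x y
    using assms(1,5) by (rule integral_vote_loss_dirichlet)
  show "loss_given_correct n f D (dirichlet n p) p
      = cond_expectation D
          (\<lambda>(x, y). reg_inc_beta (1/2) (l1_norm n p - wrong_weight n f p x y)
                      (wrong_weight n f p x y))
          (\<lambda>(x, y). wrong_weight n f p x y < l1_norm n p / 2)"
    unfolding loss_given_correct_def
    by (intro cond_expectation_cong) (simp_all add: split_beta vote_loss loss_iff)
  show "loss_given_wrong n f D (dirichlet n p) p
      = cond_expectation D
          (\<lambda>(x, y). reg_inc_beta (1/2) (l1_norm n p - wrong_weight n f p x y)
                      (wrong_weight n f p x y))
          (\<lambda>(x, y). wrong_weight n f p x y \<ge> l1_norm n p / 2)"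
    unfolding loss_given_wrong_def
    by (intro cond_expectation_cong) (simp_all add: split_beta vote_loss loss_iff)
qed

end
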